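(* Let $\mathbb{R}^{(4,4)}$ denote $\mathbb{R}^8$ with an inner product $\langle\cdot,\cdot\rangle$ of signature $(4,4)$. (1) There exist skew-symmetric endomorphisms $\phi_1,\phi_2$ of $\mathbb{R}^{(4,4)}$ such that $\phi_1^2=\phi_2^2=\phi_1\phi_2+\phi_2\phi_1=0$ and $\phi_1\phi_2\ne0$. (2) With $\phi_1,\phi_2$ as in (1), set $A=-\frac13\{A_{\phi_1}+A_{\phi_2}\}$. Then $\mathcal{J}_A(x)^2=0$ for all $x$. Furthermore, $A$ is not Jacobi--Tsankov.
   Context: An endomorphism $\phi$ is skew-symmetric if $\langle\phi x,y\rangle=-\langle x,\phi y\rangle$ for all $x,y$. For such $\phi$, $A_\phi$ is the algebraic curvature tensor $$A_\phi(x,y,z,w):=\langle\phi y,z\rangle\langle\phi x,w\rangle-\langle\phi x,z\rangle\langle\phi y,w\rangle-2\langle\phi x,y\rangle\langle\phi z,w\rangle.$$ For an algebraic curvature tensor $A$ on an inner product space $V$, the curvature operator $\mathcal{A}(x,y)\in\operatorname{End}(V)$ is defined by $\langle\mathcal{A}(x,y)z,w\rangle=A(x,y,z,w)$, and the Jacobi operator is $\mathcal{J}_A(x):y\mapsto\mathcal{A}(y,x)x$. $A$ is Jacobi--Tsankov if $\mathcal{J}_A(x)\mathcal{J}_A(y)=\mathcal{J}_A(y)\mathcal{J}_A(x)$ for all $x,y\in V$. *)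

theory Defs
  imports "HOL-Analysis.Analysis"
begin

text \<open>An inner product is a nondegenerate, possibly indefinite, symmetric bilinear form
  \<open>g\<close>.  Its signature is \<open>(p, q)\<close> if there is a basis, orthonormal up to sign, in which \<open>p\<close>
  vectors have square \<open>1\<close> and \<open>q\<close> vectors have square \<open>-1\<close>; this entails nondegeneracy.\<close>

definition inner_product_of_signature ::
    "nat \<Rightarrow> nat \<Rightarrow> ('a::real_vector \<Rightarrow> 'a \<Rightarrow> real) \<Rightarrow> bool" where
  "inner_product_of_signature p q g \<longleftrightarrow>
     bilinear g \<and> (\<forall>x y. g x y = g y x) \<and>
     (\<exists>P N. finite P \<and> finite N \<and> P \<inter> N = {} \<and> card P = p \<and> card N = q \<and>
        independent (P \<union> N) \<and> span (P \<union> N) = UNIV \<and>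
        (\<forall>b\<in>P \<union> N. \<forall>c\<in>P \<union> N. b \<noteq> c \<longrightarrow> g b c = 0) \<and>
        (\<forall>b\<in>P. g b b = 1) \<and> (\<forall>b\<in>N. g b b = - 1))"

definition skew_symmetric ::
    "('a::real_vector \<Rightarrow> 'a \<Rightarrow> real) \<Rightarrow> ('a \<Rightarrow> 'a) \<Rightarrow> bool" where
  "skew_symmetric g \<phi> \<longleftrightarrow> linear \<phi> \<and> (\<forall>x y. g (\<phi> x) y = - g x (\<phi> y))"

definition algebraic_curvature_tensor ::
    "('a::real_vector \<Rightarrow> 'a \<Rightarrow> 'a \<Rightarrow> 'a \<Rightarrow> real) \<Rightarrow> bool" where
  "algebraic_curvature_tensor A \<longleftrightarrow>
     (\<forall>y z w. linear (\<lambda>x. A x y z w)) \<and> (\<forall>x z w. linear (\<lambda>y. A x y z w)) \<and>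
     (\<forall>x y w. linear (\<lambda>z. A x y z w)) \<and> (\<forall>x y z. linear (\<lambda>w. A x y z w)) \<and>
     (\<forall>x y z w. A x y z w = - A y x z w) \<and>
     (\<forall>x y z w. A x y z w = A z w x y) \<and>
     (\<forall>x y z w. A x y z w + A y z x w + A z x y w = 0)"

definition curvature_of_endo ::
    "('a::real_vector \<Rightarrow> 'a \<Rightarrow> real) \<Rightarrow> ('a \<Rightarrow> 'a) \<Rightarrow> 'a \<Rightarrow> 'a \<Rightarrow> 'a \<Rightarrow> 'a \<Rightarrow> real" where
  "curvature_of_endo g \<phi> x y z w =
     g (\<phi> y) z * g (\<phi> x) w - g (\<phi> x) z * g (\<phi> y) w - 2 * g (\<phi> x) y * g (\<phi> z) w"

definition curvature_operator ::
    "('a::real_vector \<Rightarrow> 'a \<Rightarrow> real) \<Rightarrow> ('a \<Rightarrow> 'a \<Rightarrow> 'a \<Rightarrow> 'a \<Rightarrow> real) \<Rightarrow> 'a \<Rightarrow> 'a \<Rightarrow> 'a \<Rightarrow> 'a" where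
  "curvature_operator g A x y z = (THE u. \<forall>w. g u w = A x y z w)"

text \<open>The description is proper: for an inner product in the above sense and an algebraic
  curvature tensor such a \<open>u\<close> exists and is unique.\<close>

lemma riesz_signature:
  assumes g: "inner_product_of_signature p q g" and f: "linear (f :: 'a::real_vector \<Rightarrow> real)"
  shows "\<exists>!u. \<forall>w. g u w = f w"
proof -
  obtain P N where fin: "finite P" "finite N" and disj: "P \<inter> N = {}"
    and sp: "span (P \<union> N) = UNIV"
    and orth: "\<And>b c. b \<in> P \<union> N \<Longrightarrow> c \<in> P \<union> N \<Longrightarrow> b \<noteq> c \<Longrightarrow> g b c = 0"
    and P: "\<And>b. b \<in> P \<Longrightarrow> g b b = 1" and N: "\<And>b. b \<in> N \<Longrightarrow> g b b = - 1"
    using g unfolding inner_product_of_signature_def by metis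
  have lin1: "linear (\<lambda>x. g x y)" and lin2: "linear (\<lambda>y. g x y)" for x y
    using g unfolding inner_product_of_signature_def bilinear_def by auto
  have sym: "g x y = g y x" for x y
    using g unfolding inner_product_of_signature_def by simp
  have sq: "g b b * g b b = 1" if "b \<in> P \<union> N" for b
    using that P N by auto
  define u where "u = (\<Sum>b\<in>P \<union> N. (f b * g b b) *\<^sub>R b)"
  have gu: "g u c = f c" if c: "c \<in> P \<union> N" for c
  proof -
    have "g u c = (\<Sum>b\<in>P \<union> N. f b * g b b * g b c)"
      unfolding u_def by (simp add: linear_sum[OF lin1] linear_cmul[OF lin1])
    also have "\<dots> = (\<Sum>b\<in>P \<union> N. if b = c then f c else 0)"
      using orth sq c by (intro sum.cong) (simp_all add: mult.assoc)
    also have "\<dots> = f c" using c fin by simp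
    finally show ?thesis .
  qed
  have ex: "\<forall>w. g u w = f w"
  proof
    fix w
    show "g u w = f w"
      by (rule linear_eq_on_span[OF lin2 f, of "P \<union> N" u]) (simp_all only: gu sp UNIV_I)
  qed
  have "v = u" if v: "\<forall>w. g v w = f w" for v
  proof -
    have z: "g (v - u) w = 0" for w
      using v ex by (simp add: linear_diff[OF lin1])
    obtain r where r: "v - u = (\<Sum>b\<in>P \<union> N. r b *\<^sub>R b)"
      using sp fin span_finite[of "P \<union> N"] by auto
    have "r c = 0" if c: "c \<in> P \<union> N" for c
    proof -
      have "g (v - u) c = (\<Sum>b\<in>P \<union> N. r b * g b c)"
        unfolding r by (simp add: linear_sum[OF lin1] linear_cmul[OF lin1])
      also have "\<dots> = (\<Sum>b\<in>P \<union> N. if b = c then r c * g c c else 0)"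
        using orth c by (intro sum.cong) simp_all
      also have "\<dots> = r c * g c c" using c fin by simp
      finally show ?thesis using z sq[OF c] by auto
    qed
    then have "v - u = 0" unfolding r by simp
    then show ?thesis by simp
  qed
  with ex show ?thesis by blast
qed

lemma curvature_operator_char:
  assumes "inner_product_of_signature p q g" and "algebraic_curvature_tensor A"
  shows "g (curvature_operator g A x y z) w = A x y z w"
proof -
  have "linear (A x y z)"
    using assms(2) unfolding algebraic_curvature_tensor_def by blast
  from theI'[OF riesz_signature[OF assms(1) this]] show ?thesis
    unfolding curvature_operator_def by blast
qed

definition jacobi_operator ::
    "('a::real_vector \<Rightarrow> 'a \<Rightarrow> real) \<Rightarrow> ('a \<Rightarrow> 'a \<Rightarrow> 'a \<Rightarrow> 'a \<Rightarrow> real) \<Rightarrow> 'a \<Rightarrow> 'a \<Rightarrow> 'a" where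
  "jacobi_operator g A x = (\<lambda>y. curvature_operator g A y x x)"

definition jacobi_tsankov ::
    "('a::real_vector \<Rightarrow> 'a \<Rightarrow> real) \<Rightarrow> ('a \<Rightarrow> 'a \<Rightarrow> 'a \<Rightarrow> 'a \<Rightarrow> real) \<Rightarrow> bool" where
  "jacobi_tsankov g A \<longleftrightarrow>
     (\<forall>x y. jacobi_operator g A x \<circ> jacobi_operator g A y =
            jacobi_operator g A y \<circ> jacobi_operator g A x)"

definition admissible_pair ::
    "('a::real_vector \<Rightarrow> 'a \<Rightarrow> real) \<Rightarrow> ('a \<Rightarrow> 'a) \<Rightarrow> ('a \<Rightarrow> 'a) \<Rightarrow> bool" where
  "admissible_pair g \<phi>\<^sub>1 \<phi>\<^sub>2 \<longleftrightarrow>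
     skew_symmetric g \<phi>\<^sub>1 \<and> skew_symmetric g \<phi>\<^sub>2 \<and>
     \<phi>\<^sub>1 \<circ> \<phi>\<^sub>1 = (\<lambda>x. 0) \<and> \<phi>\<^sub>2 \<circ> \<phi>\<^sub>2 = (\<lambda>x. 0) \<and>
     (\<lambda>x. \<phi>\<^sub>1 (\<phi>\<^sub>2 x) + \<phi>\<^sub>2 (\<phi>\<^sub>1 x)) = (\<lambda>x. 0) \<and>
     \<phi>\<^sub>1 \<circ> \<phi>\<^sub>2 \<noteq> (\<lambda>x. 0)"

end

(* Part (1): a neutral space of dimension 8 is W + W* with dim W = 4, and every endomorphism a of W
   extends to the skew-symmetric endomorphism (a, -a^T) of W + W*.  Identify W with the exterior
   algebra of the plane and take for a the two exterior multiplications by the basis vectors of the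
   plane: they square to zero, anticommute, and their product is not zero.

   Part (2): skew-symmetry gives J(x) y = g(phi1 y, x) phi1 x + g(phi2 y, x) phi2 x.  The vectors
   phi1 x and phi2 x span a totally isotropic subspace because
   2 g(phi_i x, phi_j x) = - g(x, (phi_i phi_j + phi_j phi_i) x) = 0, so J(x)^2 = 0.  If x, y are
   chosen with a = g(phi1 x, phi2 y) nonzero, then the endomorphism J(x) J(y) pairs phi1 x with
   phi2 y to a^3, whereas J(y) J(x) pairs them to 0. *)
theory Submission imports Defs begin

text \<open>The sum and the difference of a positive and a negative unit vector orthogonal to each
  other are null. Matching the two halves of an orthonormal basis in this way yields dual bases of
  the W and W* used in part (1).\<close>

lemma neutral_hyperbolic_basis:
  fixes g :: "'a::real_vector \<Rightarrow> 'a \<Rightarrow> real"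
  assumes "inner_product_of_signature n n g"
  obtains w v :: "nat \<Rightarrow> 'a" where
    "\<And>i j. i < n \<Longrightarrow> j < n \<Longrightarrow> g (w i) (v j) = (if i = j then 1 else 0)"
    "\<And>i j. i < n \<Longrightarrow> j < n \<Longrightarrow> g (w i) (w j) = 0"
    "\<And>i j. i < n \<Longrightarrow> j < n \<Longrightarrow> g (v i) (v j) = 0"
proof -
  obtain P N where fin: "finite P" "finite N" and disj: "P \<inter> N = {}"
    and cards: "card P = n" "card N = n"
    and orth: "\<And>b c. b \<in> P \<union> N \<Longrightarrow> c \<in> P \<union> N \<Longrightarrow> b \<noteq> c \<Longrightarrow> g b c = 0"
    and P: "\<And>b. b \<in> P \<Longrightarrow> g b b = 1" and N: "\<And>b. b \<in> N \<Longrightarrow> g b b = - 1"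
    using assms unfolding inner_product_of_signature_def by metis
  have bil: "bilinear g"
    using assms unfolding inner_product_of_signature_def by blast
  note bilinear = bilinear_ladd[OF bil] bilinear_radd[OF bil] bilinear_lsub[OF bil]
    bilinear_rsub[OF bil] bilinear_lmul[OF bil] bilinear_rmul[OF bil]
  obtain e where e: "bij_betw e {0..<n} P"
    using ex_bij_betw_nat_finite[OF fin(1)] unfolding cards by blast
  obtain f where f: "bij_betw f {0..<n} N"
    using ex_bij_betw_nat_finite[OF fin(2)] unfolding cards by blast
  have mem: "e i \<in> P" "f i \<in> N" if "i < n" for i
    using that e f by (auto simp: bij_betw_def)
  have ee: "g (e i) (e j) = (if i = j then 1 else 0)" if "i < n" "j < n" for i j
    using that mem[of i] mem[of j] P orth bij_betw_imp_inj_on[OF e] by (auto simp: inj_on_eq_iff)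
  have ff: "g (f i) (f j) = (if i = j then - 1 else 0)" if "i < n" "j < n" for i j
    using that mem[of i] mem[of j] N orth bij_betw_imp_inj_on[OF f] by (auto simp: inj_on_eq_iff)
  have ef: "g (e i) (f j) = 0" "g (f j) (e i) = 0" if "i < n" "j < n" for i j
    using that mem[of i] mem[of j] disj by (auto intro!: orth)
  show thesis
    \<comment> \<open>The factor 1/2 normalizes the pairing: the positive and the negative square
      contribute 1 each.\<close>
    by (rule that[of "\<lambda>i. e i + f i" "\<lambda>i. (1 / 2) *\<^sub>R (e i - f i)"])
      (simp_all add: bilinear ee ff ef)
qed

lemma neutral_admissible_pair:
  assumes g: "inner_product_of_signature 4 4 g"
  shows "\<exists>\<phi> \<psi>. admissible_pair g \<phi> \<psi>"
proof -
  obtain w v :: "nat \<Rightarrow> 'a" where wv: "\<And>i j. i < 4 \<Longrightarrow> j < 4 \<Longrightarrow> g (w i) (v j) = (if i = j then 1 else 0)"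
    and ww: "\<And>i j. i < 4 \<Longrightarrow> j < 4 \<Longrightarrow> g (w i) (w j) = 0"
    and vv: "\<And>i j. i < 4 \<Longrightarrow> j < 4 \<Longrightarrow> g (v i) (v j) = 0"
    using neutral_hyperbolic_basis[OF g] by blast
  have bil: "bilinear g" and sym: "g x y = g y x" for x y
    using g unfolding inner_product_of_signature_def by simp_all
  have vw: "g (v i) (w j) = (if i = j then 1 else 0)" if "i < 4" "j < 4" for i j
    using wv[OF that(2,1)] sym by auto
  note bilinear = bilinear_ladd[OF bil] bilinear_radd[OF bil] bilinear_lsub[OF bil]
    bilinear_rsub[OF bil] bilinear_lmul[OF bil] bilinear_rmul[OF bil] bilinear_lzero[OF bil]
    bilinear_rzero[OF bil]
  note gram = wv ww vv vw
  \<comment> \<open>With \<open>w\<close> the basis \<open>1, e\<^sub>1, e\<^sub>2, e\<^sub>1 \<and> e\<^sub>2\<close> and \<open>v\<close> its dual, these are the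
    extensions of exterior multiplication by \<open>e\<^sub>1\<close> and by \<open>e\<^sub>2\<close>.\<close>
  define \<phi> where "\<phi> x = g (v 0) x *\<^sub>R w 1 - g (w 1) x *\<^sub>R v 0 + g (v 2) x *\<^sub>R w 3 - g (w 3) x *\<^sub>R v 2" for x
  define \<psi> where "\<psi> x = g (v 0) x *\<^sub>R w 2 - g (w 2) x *\<^sub>R v 0 - g (v 1) x *\<^sub>R w 3 + g (w 3) x *\<^sub>R v 1" for x
  have "linear \<phi>" "linear \<psi>"
    unfolding \<phi>_def \<psi>_def by (rule linearI; simp add: bilinear algebra_simps)+
  moreover have "g (\<phi> x) y = - g x (\<phi> y)" "g (\<psi> x) y = - g x (\<psi> y)" for x y
    unfolding \<phi>_def \<psi>_def by (simp_all add: bilinear sym algebra_simps)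
  \<comment> \<open>Both maps take values in the span of the \<open>w i\<close> and
    \<open>v i\<close>, so the outer map is evaluated only there and the Gram relations suffice for
    arbitrary \<open>x\<close>.\<close>
  moreover have "\<phi> (\<phi> x) = 0" "\<psi> (\<psi> x) = 0" "\<phi> (\<psi> x) + \<psi> (\<phi> x) = 0" for x
    unfolding \<phi>_def \<psi>_def by (simp_all add: bilinear gram)
  \<comment> \<open>The unit \<open>w 0\<close> goes to \<open>w 2\<close> under
    \<open>\<psi>\<close> and then to \<open>w 3\<close> under \<open>\<phi>\<close>, which
    \<open>v 3\<close> detects.\<close>
  moreover have "\<phi> (\<psi> (w 0)) \<noteq> 0"
  proof
    assume "\<phi> (\<psi> (w 0)) = 0"
    then have "g (\<phi> (\<psi> (w 0))) (v 3) = 0" by (simp add: bilinear)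
    then show False unfolding \<phi>_def \<psi>_def by (simp add: bilinear gram)
  qed
  ultimately have "admissible_pair g \<phi> \<psi>"
    unfolding admissible_pair_def skew_symmetric_def by (auto simp: fun_eq_iff)
  then show ?thesis by blast
qed

text \<open>By skew-symmetry \<open>g (\<phi> x) y\<close> is an alternating form in
  \<open>x\<close> and \<open>y\<close>. In the cyclic sum the first two products each give the same
  sum S and the last one gives -2 S, whence the coefficient 2.\<close>

lemma algebraic_curvature_tensor_curvature_of_endo:
  assumes g: "inner_product_of_signature p q g" and \<phi>: "skew_symmetric g \<phi>"
  shows "algebraic_curvature_tensor (curvature_of_endo g \<phi>)"
proof -
  have bil: "bilinear g" and sym: "g x y = g y x" for x y
    using g unfolding inner_product_of_signature_def by simp_all
  have lin: "linear \<phi>" and skew': "g (\<phi> x) y = - g x (\<phi> y)" for x y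
    using \<phi> unfolding skew_symmetric_def by blast+
  have skew: "g (\<phi> x) y = - g (\<phi> y) x" for x y
    unfolding skew'[of x y] sym[of x "\<phi> y"] ..
  note simps = bilinear_ladd[OF bil] bilinear_radd[OF bil]
    bilinear_lmul[OF bil] bilinear_rmul[OF bil] linear_add[OF lin] linear_cmul[OF lin]
  show ?thesis
    unfolding algebraic_curvature_tensor_def curvature_of_endo_def
  proof (intro conjI allI, goal_cases)
    \<comment> \<open>Cases 5 to 7 are antisymmetry, pair symmetry and the Bianchi identity; cases 1
      to 4, multilinearity, fall to the closing \<open>linearI\<close>.\<close>
    case (5 x y z w)
    show ?case using skew[of x y] by (simp add: algebra_simps)
  next
    case (6 x y z w)
    show ?case
      using skew[of x w] skew[of y z] skew[of x z] skew[of y w] by (simp add: algebra_simps)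
  next
    case (7 x y z w)
    show ?case using skew[of y x] skew[of z x] skew[of z y] by (simp add: algebra_simps)
  qed (rule linearI; simp add: simps algebra_simps)+
qed

lemma algebraic_curvature_tensorD:
  assumes "algebraic_curvature_tensor A"
  shows "linear (\<lambda>x. A x y z w)" "linear (\<lambda>y. A x y z w)"
    "linear (\<lambda>z. A x y z w)" "linear (\<lambda>w. A x y z w)"
    and "A x y z w = - A y x z w"
    and "A x y z w = A z w x y"
    and "A x y z w + A y z x w + A z x y w = 0"
  using assms[unfolded algebraic_curvature_tensor_def] by metis+

lemma algebraic_curvature_tensor_add:
  assumes A: "algebraic_curvature_tensor A" and B: "algebraic_curvature_tensor B"
  shows "algebraic_curvature_tensor (\<lambda>x y z w. A x y z w + B x y z w)"
  unfolding algebraic_curvature_tensor_def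
proof (intro conjI allI)
  fix x y z w
  \<comment> \<open>Each tensor contributes seven facts, so the k-th one for \<open>B\<close> has
    index k + 7.\<close>
  note AB = algebraic_curvature_tensorD[OF A] algebraic_curvature_tensorD[OF B]
  show "linear (\<lambda>x. A x y z w + B x y z w)" "linear (\<lambda>y. A x y z w + B x y z w)"
    "linear (\<lambda>z. A x y z w + B x y z w)" "linear (\<lambda>w. A x y z w + B x y z w)"
    by (intro linear_compose_add AB)+
  show "A x y z w + B x y z w = - (A y x z w + B y x z w)"
    using AB(5,12)[of x y z w] by simp
  show "A x y z w + B x y z w = A z w x y + B z w x y"
    using AB(6,13)[of x y z w] by simp
  show "(A x y z w + B x y z w) + (A y z x w + B y z x w) + (A z x y w + B z x y w) = 0"
    using AB(7,14)[of x y z w] by simp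
qed

lemma algebraic_curvature_tensor_scale:
  assumes A: "algebraic_curvature_tensor A"
  shows "algebraic_curvature_tensor (\<lambda>x y z w. c * A x y z w)"
  unfolding algebraic_curvature_tensor_def
proof (intro conjI allI)
  fix x y z w
  note A = algebraic_curvature_tensorD[OF A]
  note scale = linear_compose_scale_right[where 'b = real and c = c, unfolded real_scaleR_def]
  show "linear (\<lambda>x. c * A x y z w)" "linear (\<lambda>y. c * A x y z w)"
    "linear (\<lambda>z. c * A x y z w)" "linear (\<lambda>w. c * A x y z w)"
    by (intro scale A)+
  show "c * A x y z w = - (c * A y x z w)"
    using A(5)[of x y z w] by simp
  show "c * A x y z w = c * A z w x y"
    using A(6)[of x y z w] by simp
  have "c * (A x y z w + A y z x w + A z x y w) = 0"
    unfolding A(7) by simp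
  then show "c * A x y z w + c * A y z x w + c * A z x y w = 0"
    by (simp only: distrib_left)
qed

theorem lemma2p2:
  fixes g :: "real ^ 8 \<Rightarrow> real ^ 8 \<Rightarrow> real"
  assumes "inner_product_of_signature 4 4 g"
  shows "(\<exists>\<phi>\<^sub>1 \<phi>\<^sub>2. admissible_pair g \<phi>\<^sub>1 \<phi>\<^sub>2) \<and>
    (\<forall>\<phi>\<^sub>1 \<phi>\<^sub>2 A. admissible_pair g \<phi>\<^sub>1 \<phi>\<^sub>2 \<longrightarrow>
       A = (\<lambda>x y z w. - (1 / 3) * (curvature_of_endo g \<phi>\<^sub>1 x y z w + curvature_of_endo g \<phi>\<^sub>2 x y z w)) \<longrightarrow>
       algebraic_curvature_tensor A \<and>
       (\<forall>x. jacobi_operator g A x \<circ> jacobi_operator g A x = (\<lambda>y. 0)) \<and>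
       \<not> jacobi_tsankov g A)"
proof (intro conjI allI impI)
  show "\<exists>\<phi>\<^sub>1 \<phi>\<^sub>2. admissible_pair g \<phi>\<^sub>1 \<phi>\<^sub>2"
    using assms by (rule neutral_admissible_pair)
next
  fix \<phi> \<psi> A
  assume adm: "admissible_pair g \<phi> \<psi>"
    and A: "A = (\<lambda>x y z w. - (1 / 3) * (curvature_of_endo g \<phi> x y z w + curvature_of_endo g \<psi> x y z w))"
  have skew: "skew_symmetric g \<phi>" "skew_symmetric g \<psi>"
    using adm unfolding admissible_pair_def by blast+
  show alg: "algebraic_curvature_tensor A"
    unfolding A using assms skew
    by (intro algebraic_curvature_tensor_scale algebraic_curvature_tensor_add
        algebraic_curvature_tensor_curvature_of_endo)
  have bil: "bilinear g" and sym: "g x y = g y x" for x y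
    using assms unfolding inner_product_of_signature_def by simp_all
  note bilinear = bilinear_ladd[OF bil] bilinear_radd[OF bil] bilinear_lmul[OF bil]
    bilinear_rmul[OF bil] bilinear_lneg[OF bil] bilinear_rneg[OF bil] bilinear_lzero[OF bil]
    bilinear_rzero[OF bil]
  \<comment> \<open>Uniqueness of the vector representing the functional
    \<open>g u'\<close>.\<close>
  have nondeg: "u = u'" if "\<And>w. g u w = g u' w" for u u'
  proof -
    have "linear (g u')" using bil unfolding bilinear_def by blast
    from riesz_signature[OF assms this] that show ?thesis by blast
  qed
  have skew_\<phi>: "g (\<phi> x) y = - g x (\<phi> y)" and skew_\<psi>: "g (\<psi> x) y = - g x (\<psi> y)" for x y
    using skew unfolding skew_symmetric_def by blast+
  have sq: "\<phi> (\<phi> x) = 0" "\<psi> (\<psi> x) = 0" and anti: "\<psi> (\<phi> x) = - \<phi> (\<psi> x)" for x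
    using adm unfolding admissible_pair_def by (auto simp: fun_eq_iff eq_neg_iff_add_eq_0 add.commute)
  \<comment> \<open>As \<open>g (\<phi> x) x = 0\<close>, the curvature tensor of
    \<open>\<phi>\<close> at \<open>y, x, x, w\<close> is
    \<open>- 3 * g (\<phi> y) x * g (\<phi> x) w\<close>, and likewise for \<open>\<psi>\<close>;
    the factor -1/3 cancels the -3.\<close>
  have jacobi: "jacobi_operator g A x y = g (\<phi> y) x *\<^sub>R \<phi> x + g (\<psi> y) x *\<^sub>R \<psi> x" for x y
  proof (rule nondeg)
    fix w
    have "g (\<phi> x) x = 0" "g (\<psi> x) x = 0"
      using skew_\<phi>[of x x] skew_\<psi>[of x x] by (simp_all add: sym)
    then show "g (jacobi_operator g A x y) w = g (g (\<phi> y) x *\<^sub>R \<phi> x + g (\<psi> y) x *\<^sub>R \<psi> x) w"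
      unfolding jacobi_operator_def curvature_operator_char[OF assms alg]
      by (simp add: A curvature_of_endo_def bilinear field_simps)
  qed
  \<comment> \<open>Skew-symmetry moves the left endomorphism to the right, where squares vanish and
    mixed products anticommute. So \<open>g (\<phi> x) (\<psi> y)\<close> is alternating in
    \<open>x\<close> and \<open>y\<close>.\<close>
  have gram: "g (\<phi> x) (\<phi> y) = 0" "g (\<psi> x) (\<psi> y) = 0" "g (\<psi> x) (\<phi> y) = - g (\<phi> x) (\<psi> y)" for x y
    by (simp_all add: skew_\<phi>[of x] skew_\<psi>[of x] sq anti bilinear)
  have gram_diag: "g (\<phi> x) (\<psi> x) = 0" for x
    using gram(3)[of x x] by (simp add: sym)
  have lin: "linear \<phi>" "linear \<psi>"
    using skew unfolding skew_symmetric_def by blast+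
  note lins = linear_add[OF lin(1)] linear_add[OF lin(2)] linear_cmul[OF lin(1)] linear_cmul[OF lin(2)]
    linear_neg[OF lin(1)] linear_neg[OF lin(2)]
  \<comment> \<open>The coefficients of the second application reduce to pairings among
    \<open>\<phi> x\<close> and \<open>\<psi> x\<close>, all zero.\<close>
  show "jacobi_operator g A x \<circ> jacobi_operator g A x = (\<lambda>y. 0)" for x
    by (simp add: fun_eq_iff jacobi lins bilinear sq anti skew_\<phi>[of "\<psi> _"] gram gram_diag)
  show "\<not> jacobi_tsankov g A"
  proof
    assume JT: "jacobi_tsankov g A"
    obtain y where "\<phi> (\<psi> y) \<noteq> 0"
      using adm unfolding admissible_pair_def by (auto simp: fun_eq_iff)
    then obtain x where "g (\<phi> (\<psi> y)) x \<noteq> 0"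
      using nondeg[of "\<phi> (\<psi> y)" 0] by (auto simp: bilinear)
    then have a: "g (\<phi> x) (\<psi> y) \<noteq> 0"
      using skew_\<phi>[of x "\<psi> y"] sym by simp
    \<comment> \<open>Put a = \<open>g (\<phi> x) (\<psi> y)\<close>. The operator at
      \<open>y\<close> sends \<open>\<phi> x\<close> to -a times \<open>\<psi> y\<close>, and the
      one at \<open>x\<close> sends \<open>\<psi> y\<close> to -a times \<open>\<phi> x\<close>: the
      left side is a cubed. The operator at \<open>x\<close> kills \<open>\<phi> x\<close> by
      \<open>gram_diag\<close>, so the right side is 0.\<close>
    have "g (jacobi_operator g A x (jacobi_operator g A y (\<phi> x))) (\<psi> y)
        = g (jacobi_operator g A y (jacobi_operator g A x (\<phi> x))) (\<psi> y)"
      using JT unfolding jacobi_tsankov_def by (metis comp_apply)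
    moreover have "g (\<phi> y) (\<psi> x) = - g (\<phi> x) (\<psi> y)"
      using gram(3)[of x y] sym by simp
    ultimately have "g (\<phi> x) (\<psi> y) ^ 3 = 0"
      by (simp add: jacobi lins bilinear sq anti skew_\<phi>[of "\<psi> _"] gram gram_diag power3_eq_cube)
    with a show False by simp
  qed
qed

end
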